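(* For every $k,q\in\mathbb{N}$, every finite predicate family $\mathcal{F}\subseteq\{f:\mathbb{Z}_q^k\to\{0,1\}\}$ and every $\epsilon>0$, there exists an $(\omega(\mathcal{F}),\rho(\mathcal{F})+\epsilon)$-integrality gap instance for the basic LP for $\textsc{Max-CSP}(\mathcal{F})$, i.e., an instance $\Phi$ with $\mathrm{opt}^{\mathrm{CSP}}_\Phi\le\rho(\mathcal{F})+\epsilon$ and $\mathrm{opt}^{\mathrm{LP}}_\Phi\ge\omega(\mathcal{F})$.
   Context: Variables take values in $\mathbb{Z}_q$. An instance $\Phi$ of $\textsc{Max-CSP}(\mathcal{F})$ on variables $x_1,\dots,x_n$ is a list of constraints with non-negative integer weights; each constraint is a pair $C=(f,\mathbf{j})$ with $f\in\mathcal{F}$ and $\mathbf{j}=(j_1,\dots,j_k)\in[n]^k$ having distinct coordinates. An assignment $\mathbf{b}\in\mathbb{Z}_q^n$ satisfies $C$ if $f(b_{j_1},\dots,b_{j_k})=1$; $\mathrm{val}^{\mathrm{CSP}}_\Phi(\mathbf{b})$ is the weighted fraction of constraints satisfied and $\mathrm{opt}^{\mathrm{CSP}}_\Phi=\max_{\mathbf{b}}\mathrm{val}^{\mathrm{CSP}}_\Phi(\mathbf{b})$. Define $\rho(\mathcal{F})=\lim_{n\to\infty}\inf\{\mathrm{opt}^{\mathrm{CSP}}_\Psi:\Psi\text{ an instance of }\textsc{Max-CSP}(\mathcal{F})\text{ on }n\text{ variables}\}$. Basic LP: a feasible solution for $\Phi$ is a tuple of local distributions $(Y_C\in\Delta(\mathbb{Z}_q^k))_{C\in\Phi}$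 together with $X_i\in\Delta(\mathbb{Z}_q)$ for $i\in[n]$ such that for every constraint $C=(f,\mathbf{j})$ and $\ell\in[k]$, the marginal of $Y_C$ on coordinate $\ell$ equals $X_{j_\ell}$. Its value is the weighted average over constraints $C=(f,\mathbf{j})$ of $\mathbb{E}_{\mathbf{a}\sim Y_C}[f(\mathbf{a})]$; $\mathrm{opt}^{\mathrm{LP}}_\Phi$ is the maximum value. A $(\gamma,\beta)$-integrality gap instance is an instance with $\mathrm{opt}^{\mathrm{CSP}}_\Phi\le\beta$ and $\mathrm{opt}^{\mathrm{LP}}_\Phi\ge\gamma$. Width: for $\mathbf{b}\in\mathbb{Z}_q^k$ and $f:\mathbb{Z}_q^k\to\{0,1\}$, $\omega_{\mathbf{b}}(f)=|\{a\in\mathbb{Z}_q: f(\mathbf{b}+a^k)=1\}|/q$, where $a^k=(a,\dots,a)$; $\omega(f)=\max_{\mathbf{b}\in\mathbb{Z}_q^k}\omega_{\mathbf{b}}(f)$; and $\omega(\mathcal{F})=\min_{f\in\mathcal{F}}\omega(f)$. *)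

theory Defs
  imports "HOL-Probability.Probability_Mass_Function"
begin

text \<open>
  \<open>\<int>\<^sub>q\<close> is \<open>{..<q}\<close> with addition modulo \<open>q\<close>, and the variables
  \<open>x\<^sub>1, \<dots>, x\<^sub>n\<close> are indexed from 0, by \<open>{..<n}\<close>. A predicate is a function
  \<open>\<int>\<^sub>q\<^sup>k \<rightarrow> {0, 1}\<close>, made total by extensionality.
\<close>

definition Zq_pow :: "nat \<Rightarrow> nat \<Rightarrow> nat list set" where
  "Zq_pow q m = {b. set b \<subseteq> {..<q} \<and> length b = m}"

type_synonym predicate = "nat list \<Rightarrow> nat"

definition predicates :: "nat \<Rightarrow> nat \<Rightarrow> predicate set" where
  "predicates q k = Zq_pow q k \<rightarrow>\<^sub>E {0, 1}"


subsection \<open>Max-CSP\<close>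

type_synonym csp_constraint = "predicate \<times> nat list"

type_synonym csp_instance = "(nat \<times> csp_constraint) list"

definition total_weight :: "csp_instance \<Rightarrow> nat" where
  "total_weight \<Phi> = (\<Sum>(w, C)\<leftarrow>\<Phi>. w)"

text \<open>
  The total weight has to be positive for weighted fractions of constraints to make sense;
  with the convention \<open>x / 0 = 0\<close> an instance of weight 0 would have value 0.
\<close>

definition csp_instance_on :: "nat \<Rightarrow> predicate set \<Rightarrow> nat \<Rightarrow> csp_instance \<Rightarrow> bool" where
  "csp_instance_on k F n \<Phi> \<longleftrightarrow>
     (\<forall>(w, f, js) \<in> set \<Phi>. f \<in> F \<and> length js = k \<and> set js \<subseteq> {..<n} \<and> distinct js) \<and>
     total_weight \<Phi> > 0"

definition satisfies :: "nat list \<Rightarrow> csp_constraint \<Rightarrow> bool" where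
  "satisfies b C \<longleftrightarrow> (case C of (f, js) \<Rightarrow> f (map (\<lambda>j. b ! j) js) = 1)"

definition csp_val :: "csp_instance \<Rightarrow> nat list \<Rightarrow> real" where
  "csp_val \<Phi> b =
     (\<Sum>(w, C)\<leftarrow>\<Phi>. if satisfies b C then real w else 0) / real (total_weight \<Phi>)"

definition csp_opt :: "nat \<Rightarrow> nat \<Rightarrow> csp_instance \<Rightarrow> real" where
  "csp_opt q n \<Phi> = Max (csp_val \<Phi> ` Zq_pow q n)"

text \<open>
  For \<open>n < k\<close> there are no instances and the infimum below is a junk value, which
  does not affect the limit.
\<close>

definition csp_rho :: "nat \<Rightarrow> nat \<Rightarrow> predicate set \<Rightarrow> real" where
  "csp_rho q k F = lim (\<lambda>n. Inf {csp_opt q n \<Psi> | \<Psi>. csp_instance_on k F n \<Psi>})"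


subsection \<open>The basic LP\<close>

text \<open>
  The local distribution \<open>Y\<^sub>C\<close> is indexed by the position of \<open>C\<close> in the list of constraints,
  so that repeated constraints may carry different local distributions.
\<close>

definition lp_feasible ::
  "nat \<Rightarrow> nat \<Rightarrow> nat \<Rightarrow> csp_instance \<Rightarrow> (nat \<Rightarrow> nat pmf) \<Rightarrow> (nat \<Rightarrow> nat list pmf) \<Rightarrow> bool" where
  "lp_feasible q k n \<Phi> X Y \<longleftrightarrow>
     (\<forall>i<n. set_pmf (X i) \<subseteq> {..<q}) \<and>
     (\<forall>c<length \<Phi>. set_pmf (Y c) \<subseteq> Zq_pow q k) \<and>
     (\<forall>c<length \<Phi>. case \<Phi> ! c of (w, f, js) \<Rightarrow>
        (\<forall>l<k. map_pmf (\<lambda>a. a ! l) (Y c) = X (js ! l)))"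

definition lp_val :: "csp_instance \<Rightarrow> (nat \<Rightarrow> nat list pmf) \<Rightarrow> real" where
  "lp_val \<Phi> Y =
     (\<Sum>c<length \<Phi>. case \<Phi> ! c of (w, f, js) \<Rightarrow>
        real w * measure_pmf.expectation (Y c) (\<lambda>a. real (f a))) / real (total_weight \<Phi>)"

definition lp_opt :: "nat \<Rightarrow> nat \<Rightarrow> nat \<Rightarrow> csp_instance \<Rightarrow> real" where
  "lp_opt q k n \<Phi> = Sup {lp_val \<Phi> Y | X Y. lp_feasible q k n \<Phi> X Y}"

definition integrality_gap_instance ::
  "nat \<Rightarrow> nat \<Rightarrow> predicate set \<Rightarrow> real \<Rightarrow> real \<Rightarrow> nat \<Rightarrow> csp_instance \<Rightarrow> bool" where
  "integrality_gap_instance q k F \<gamma> \<beta> n \<Phi> \<longleftrightarrow>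
     csp_instance_on k F n \<Phi> \<and> csp_opt q n \<Phi> \<le> \<beta> \<and> lp_opt q k n \<Phi> \<ge> \<gamma>"


subsection \<open>Width\<close>

definition width_at :: "nat \<Rightarrow> nat list \<Rightarrow> predicate \<Rightarrow> real" where
  "width_at q b f = real (card {a \<in> {..<q}. f (map (\<lambda>x. (x + a) mod q) b) = 1}) / real q"

definition width :: "nat \<Rightarrow> nat \<Rightarrow> predicate \<Rightarrow> real" where
  "width q k f = Max ((\<lambda>b. width_at q b f) ` Zq_pow q k)"

definition family_width :: "nat \<Rightarrow> nat \<Rightarrow> predicate set \<Rightarrow> real" where
  "family_width q k F = Min (width q k ` F)"

end

theory Submission
  imports Defs
begin

text \<open>
  Every instance \<open>\<Psi>\<close> has basic LP value at least \<open>\<omega>(\<F>)\<close>: let every \<open>X\<^sub>i\<close> be uniform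
  on \<open>\<int>\<^sub>q\<close>, and for a constraint \<open>C = (f, j)\<close> let \<open>Y\<^sub>C\<close> be the law of \<open>b + a\<^sup>k\<close>, where \<open>a\<close> is
  uniform on \<open>\<int>\<^sub>q\<close> and \<open>b\<close> attains the width of \<open>f\<close>. The marginals are uniform, and
  \<open>C\<close> contributes exactly \<open>\<omega>(f)\<close>. On the other hand, unused variables do not change the value
  of an instance, so the infima defining \<open>\<rho>(\<F>)\<close> decrease with \<open>n\<close> and converge to it; hence some
  instance has value at most \<open>\<rho>(\<F>) + \<epsilon>\<close>.
\<close>

lemma finite_Zq_pow [simp]: "finite (Zq_pow q m)"
  unfolding Zq_pow_def by (rule finite_lists_length_eq) simp

lemma Zq_pow_nonempty:
  assumes "q \<ge> 1"
  shows "Zq_pow q m \<noteq> {}"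
proof -
  have "replicate m 0 \<in> Zq_pow q m"
    using assms by (auto simp: Zq_pow_def)
  then show ?thesis by blast
qed

lemma predicate_cases:
  assumes "f \<in> predicates q k" "a \<in> Zq_pow q k"
  shows "f a = 0 \<or> f a = 1"
  using PiE_mem[of f "Zq_pow q k" "\<lambda>_. {0, 1}" a] assms by (auto simp: predicates_def)

section \<open>Translates along the diagonal of \<open>\<int>\<^sub>q\<^sup>k\<close>\<close>

definition shift :: "nat \<Rightarrow> nat list \<Rightarrow> nat \<Rightarrow> nat list" where
  "shift q b a = map (\<lambda>x. (x + a) mod q) b"

lemma shift_in_Zq_pow: "q \<ge> 1 \<Longrightarrow> b \<in> Zq_pow q k \<Longrightarrow> shift q b a \<in> Zq_pow q k"
  by (auto simp: shift_def Zq_pow_def)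

text \<open>Distinct elements of \<open>{..<q}\<close> differ by less than \<open>q\<close>, so
  translation is injective; on a finite set that gives surjectivity.\<close>

lemma bij_betw_add_mod:
  fixes q x :: nat
  assumes "q \<ge> 1"
  shows "bij_betw (\<lambda>a. (x + a) mod q) {..<q} {..<q}"
proof -
  have inj: "inj_on (\<lambda>a. (x + a) mod q) {..<q}"
  proof (rule linorder_inj_onI')
    fix a a' assume a: "a \<in> {..<q}" "a' \<in> {..<q}" "a < a'"
    have "\<not> q dvd a' - a" using a by (auto dest!: dvd_imp_le)
    then show "(x + a) mod q \<noteq> (x + a') mod q"
      using a(3) mod_eq_dvd_iff_nat[of "x + a" "x + a'" q] by auto
  qed
  have "(\<lambda>a. (x + a) mod q) ` {..<q} \<subseteq> {..<q}" using assms by auto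
  then show ?thesis
    using inj by (simp add: bij_betw_def endo_inj_surj)
qed

definition shift_pmf :: "nat \<Rightarrow> nat list \<Rightarrow> nat list pmf" where
  "shift_pmf q b = map_pmf (shift q b) (pmf_of_set {..<q})"

lemma set_shift_pmf:
  assumes "q \<ge> 1" "b \<in> Zq_pow q k"
  shows "set_pmf (shift_pmf q b) \<subseteq> Zq_pow q k"
  using shift_in_Zq_pow[OF assms] by (auto simp: shift_pmf_def)

text \<open>A single coordinate of the random translate is \<open>b ! l\<close> plus a uniform
  residue, so its law does not depend on \<open>b\<close> or \<open>l\<close>. This is why
  constraints sharing variables can use different base points \<open>b\<close> and remain
  consistent.\<close>

lemma marginal_shift_pmf:
  assumes "q \<ge> 1" "l < length b"
  shows "map_pmf (\<lambda>a. a ! l) (shift_pmf q b) = pmf_of_set {..<q}"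
proof -
  have "map_pmf (\<lambda>a. a ! l) (shift_pmf q b) = map_pmf (\<lambda>a. (b ! l + a) mod q) (pmf_of_set {..<q})"
    using assms(2) by (simp add: shift_pmf_def pmf.map_comp o_def shift_def)
  also have "\<dots> = pmf_of_set {..<q}"
    using assms(1) by (intro map_pmf_of_set_bij_betw bij_betw_add_mod) (auto simp: lessThan_empty_iff)
  finally show ?thesis .
qed

lemma expectation_shift_pmf:
  assumes q: "q \<ge> 1" and b: "b \<in> Zq_pow q k" and f: "f \<in> predicates q k"
  shows "measure_pmf.expectation (shift_pmf q b) (\<lambda>a. real (f a)) = width_at q b f"
proof -
  have ne: "{..<q} \<noteq> {}" using q by (auto simp: lessThan_empty_iff)
  have "measure_pmf.expectation (shift_pmf q b) (\<lambda>a. real (f a))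
      = (\<Sum>a<q. real (f (shift q b a))) / real q"
    using ne by (simp add: shift_pmf_def integral_pmf_of_set)
  \<comment> \<open>Translates stay in \<open>Zq_pow q k\<close>, where \<open>f\<close> is
    0/1-valued, so the sum counts the satisfying translates.\<close>
  also have "(\<Sum>a<q. real (f (shift q b a))) = (\<Sum>a<q. if f (shift q b a) = 1 then 1 else 0)"
    using predicate_cases[OF f shift_in_Zq_pow[OF q b]] by (intro sum.cong) auto
  also have "\<dots> = real (card {a \<in> {..<q}. f (shift q b a) = 1})"
    by (simp add: sum.If_cases Int_def)
  finally show ?thesis by (simp add: width_at_def shift_def)
qed

lemma width_attained:
  assumes "q \<ge> 1"
  obtains b where "b \<in> Zq_pow q k" "width_at q b f = width q k f"
  using Max_in[of "(\<lambda>b. width_at q b f) ` Zq_pow q k"] Zq_pow_nonempty[OF assms, of k]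
  unfolding width_def by (metis (no_types, lifting) finite_Zq_pow finite_imageI image_iff image_is_empty)

section \<open>Lower bound on the basic LP optimum\<close>

lemma total_weight_conv_sum: "real (total_weight \<Phi>) = (\<Sum>c<length \<Phi>. real (fst (\<Phi> ! c)))"
proof -
  have "total_weight \<Phi> = (\<Sum>c<length \<Phi>. fst (\<Phi> ! c))"
    unfolding total_weight_def
    by (subst sum_list_sum_nth) (auto simp: case_prod_unfold atLeast0LessThan intro!: sum.cong)
  then show ?thesis by simp
qed

lemma csp_instance_onD:
  assumes "csp_instance_on k F n \<Phi>" "c < length \<Phi>" "\<Phi> ! c = (w, f, js)"
  shows "f \<in> F" "length js = k" "set js \<subseteq> {..<n}"
  using assms nth_mem[OF assms(2)] unfolding csp_instance_on_def by fastforce+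

text \<open>Since \<open>lp_opt\<close> is a supremum of reals, a feasible value bounds it from
  below only once the set of values is known to be bounded above.\<close>

lemma lp_val_le_1:
  assumes F: "F \<subseteq> predicates q k" and inst: "csp_instance_on k F n \<Phi>"
    and feas: "lp_feasible q k n \<Phi> X Y"
  shows "lp_val \<Phi> Y \<le> 1"
proof -
  have "(\<Sum>c<length \<Phi>. case \<Phi> ! c of (w, f, js) \<Rightarrow>
        real w * measure_pmf.expectation (Y c) (\<lambda>a. real (f a)))
      \<le> (\<Sum>c<length \<Phi>. real (fst (\<Phi> ! c)))"
  proof (rule sum_mono)
    fix c assume "c \<in> {..<length \<Phi>}"
    then have c: "c < length \<Phi>" by simp
    obtain w f js where C: "\<Phi> ! c = (w, f, js)" by (metis prod_cases3)
    have f: "f \<in> predicates q k" using csp_instance_onD(1)[OF inst c C] F by blast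
    have supp: "set_pmf (Y c) \<subseteq> Zq_pow q k"
      using feas c by (simp add: lp_feasible_def)
    have bound: "real (f a) \<le> 1" if "a \<in> set_pmf (Y c)" for a
      using predicate_cases[OF f, of a] supp that by fastforce
    have "integrable (measure_pmf (Y c)) (\<lambda>a. real (f a))"
      using supp by (intro integrable_measure_pmf_finite) (rule finite_subset, auto)
    then have "measure_pmf.expectation (Y c) (\<lambda>a. real (f a)) \<le> 1"
      using bound by (intro measure_pmf.integral_le_const) (auto simp: AE_measure_pmf_iff)
    then show "(case \<Phi> ! c of (w, f, js) \<Rightarrow>
        real w * measure_pmf.expectation (Y c) (\<lambda>a. real (f a))) \<le> real (fst (\<Phi> ! c))"
      by (simp add: C mult_left_le)
  qed
  then show ?thesis
    unfolding lp_val_def total_weight_conv_sum[symmetric] by (simp add: divide_le_eq)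
qed

lemma lp_opt_ge_family_width:
  assumes q: "q \<ge> 1" and F: "F \<subseteq> predicates q k" "finite F"
    and inst: "csp_instance_on k F n \<Phi>"
  shows "family_width q k F \<le> lp_opt q k n \<Phi>"
proof -
  have "\<exists>b. b \<in> Zq_pow q k \<and> width_at q b f = width q k f" for f
    using width_attained[OF q] by blast
  \<comment> \<open>The base point depends only on the predicate of a constraint, not on its
    variables.\<close>
  then obtain B where B: "\<And>f. B f \<in> Zq_pow q k" "\<And>f. width_at q (B f) f = width q k f"
    by metis
  define X where "X = (\<lambda>i::nat. pmf_of_set {..<q})"
  define Y where "Y c = shift_pmf q (B (fst (snd (\<Phi> ! c))))" for c
  have len: "length (B f) = k" for f using B(1)[of f] by (simp add: Zq_pow_def)
  have feas: "lp_feasible q k n \<Phi> X Y"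
    using q set_shift_pmf[OF q B(1)] marginal_shift_pmf[OF q, of _ "B _"]
    by (auto simp: lp_feasible_def X_def Y_def len lessThan_empty_iff split: prod.split)
  let ?w = "family_width q k F"
  have "?w * (\<Sum>c<length \<Phi>. real (fst (\<Phi> ! c)))
      \<le> (\<Sum>c<length \<Phi>. case \<Phi> ! c of (w, f, js) \<Rightarrow>
        real w * measure_pmf.expectation (Y c) (\<lambda>a. real (f a)))"
    unfolding sum_distrib_left
  proof (rule sum_mono)
    fix c assume "c \<in> {..<length \<Phi>}"
    then have c: "c < length \<Phi>" by simp
    obtain w f js where C: "\<Phi> ! c = (w, f, js)" by (metis prod_cases3)
    have f: "f \<in> F" using csp_instance_onD(1)[OF inst c C] .
    then have "measure_pmf.expectation (Y c) (\<lambda>a. real (f a)) = width q k f"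
      using expectation_shift_pmf[OF q B(1), of f] B(2)[of f] F(1) by (auto simp: Y_def C)
    moreover have "?w \<le> width q k f"
      unfolding family_width_def using f F(2) by simp
    ultimately show "?w * real (fst (\<Phi> ! c)) \<le> (case \<Phi> ! c of (w, f, js) \<Rightarrow>
        real w * measure_pmf.expectation (Y c) (\<lambda>a. real (f a)))"
      by (simp add: C mult.commute mult_left_mono)
  qed
  moreover have "total_weight \<Phi> > 0" using inst by (simp add: csp_instance_on_def)
  ultimately have "?w \<le> lp_val \<Phi> Y"
    unfolding lp_val_def total_weight_conv_sum[symmetric] by (simp add: pos_le_divide_eq)
  also have "\<dots> \<le> lp_opt q k n \<Phi>"
    unfolding lp_opt_def
  proof (rule cSup_upper)
    show "bdd_above {lp_val \<Phi> Y | X Y. lp_feasible q k n \<Phi> X Y}"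
      using lp_val_le_1[OF F(1) inst] by (intro bdd_aboveI[of _ 1]) auto
  qed (use feas in blast)
  finally show ?thesis .
qed

section \<open>Dependence of the CSP optimum on the number of variables\<close>

lemma csp_val_nonneg: "csp_val \<Phi> b \<ge> 0"
  unfolding csp_val_def by (intro divide_nonneg_nonneg sum_list_nonneg) auto

lemma csp_opt_nonneg:
  assumes "q \<ge> 1"
  shows "csp_opt q n \<Phi> \<ge> 0"
proof -
  obtain b where "b \<in> Zq_pow q n" using Zq_pow_nonempty[OF assms] by blast
  then have "csp_val \<Phi> b \<le> csp_opt q n \<Phi>"
    unfolding csp_opt_def by (intro Max_ge) auto
  then show ?thesis using csp_val_nonneg[of \<Phi> b] by linarith
qed

lemma csp_instance_on_mono:
  "csp_instance_on k F n \<Phi> \<Longrightarrow> n \<le> m \<Longrightarrow> csp_instance_on k F m \<Phi>"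
  unfolding csp_instance_on_def by fastforce

text \<open>Constraints only read indices below \<open>n\<close>, where \<open>take n b\<close> and
  \<open>b\<close> agree.\<close>

lemma csp_val_take:
  assumes "csp_instance_on k F n \<Phi>"
  shows "csp_val \<Phi> (take n b) = csp_val \<Phi> b"
proof -
  have "satisfies (take n b) (f, js) = satisfies b (f, js)" if "(w, f, js) \<in> set \<Phi>" for w f js
  proof -
    have "set js \<subseteq> {..<n}" using assms that unfolding csp_instance_on_def by fastforce
    then have "map (\<lambda>j. take n b ! j) js = map (\<lambda>j. b ! j) js" by (intro map_cong) auto
    then show ?thesis unfolding satisfies_def by (simp only: prod.case)
  qed
  then have "map (\<lambda>(w, C). if satisfies (take n b) C then real w else 0) \<Phi>
      = map (\<lambda>(w, C). if satisfies b C then real w else 0) \<Phi>"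
    by (intro map_cong) auto
  then show ?thesis unfolding csp_val_def by (simp only:)
qed

lemma csp_opt_antimono:
  assumes "q \<ge> 1" "csp_instance_on k F n \<Phi>" "n \<le> m"
  shows "csp_opt q m \<Phi> \<le> csp_opt q n \<Phi>"
  unfolding csp_opt_def
proof (rule Max_mono)
  show "csp_val \<Phi> ` Zq_pow q m \<subseteq> csp_val \<Phi> ` Zq_pow q n"
  proof
    fix v assume "v \<in> csp_val \<Phi> ` Zq_pow q m"
    then obtain b where b: "b \<in> Zq_pow q m" "v = csp_val \<Phi> b" by blast
    have "take n b \<in> Zq_pow q n"
      using b(1) assms(3) set_take_subset[of n b] by (auto simp: Zq_pow_def)
    then show "v \<in> csp_val \<Phi> ` Zq_pow q n"
      using csp_val_take[OF assms(2)] b(2) by (metis imageI)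
  qed
qed (use Zq_pow_nonempty[OF assms(1)] in auto)

lemma csp_instance_exists:
  assumes "F \<noteq> {}" "k \<le> n"
  shows "\<exists>\<Phi>. csp_instance_on k F n \<Phi>"
proof -
  obtain f where "f \<in> F" using assms(1) by blast
  then have "csp_instance_on k F n [(1, f, [0..<k])]"
    using assms(2) by (auto simp: csp_instance_on_def total_weight_def)
  then show ?thesis by blast
qed

lemma csp_rho_limit:
  assumes q: "q \<ge> 1" and F: "F \<noteq> {}"
  shows "(\<lambda>n. Inf {csp_opt q n \<Psi> | \<Psi>. csp_instance_on k F n \<Psi>}) \<longlonglongrightarrow> csp_rho q k F"
proof -
  let ?S = "\<lambda>n. {csp_opt q n \<Psi> | \<Psi>. csp_instance_on k F n \<Psi>}"
  have bdd: "bdd_below (?S n)" for n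
    using csp_opt_nonneg[OF q] by (intro bdd_belowI[of _ 0]) auto
  have ne: "?S n \<noteq> {}" if "k \<le> n" for n
    using csp_instance_exists[OF F that] by blast
  \<comment> \<open>An instance on \<open>n\<close> variables is also one on \<open>m\<close>
    variables, with no larger optimum; so each element of \<open>?S n\<close> is bounded below by
    one of \<open>?S m\<close>.\<close>
  have mono: "Inf (?S m) \<le> Inf (?S n)" if "k \<le> n" "n \<le> m" for m n
  proof (rule cInf_mono[OF ne[OF that(1)] bdd])
    fix v assume "v \<in> ?S n"
    then show "\<exists>a\<in>?S m. a \<le> v"
      using csp_opt_antimono[OF q _ that(2)] csp_instance_on_mono[OF _ that(2)] by blast
  qed
  \<comment> \<open>The offset \<open>k\<close> skips the indices where \<open>?S n\<close> may be
    empty and its infimum is a junk value; the limit is unaffected.\<close>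
  have "decseq (\<lambda>n. Inf (?S (n + k)))"
    using mono by (intro decseq_SucI) auto
  moreover have "0 \<le> Inf (?S (n + k))" for n
    using ne[of "n + k"] csp_opt_nonneg[OF q] by (intro cInf_greatest) auto
  ultimately obtain L where "(\<lambda>n. Inf (?S (n + k))) \<longlonglongrightarrow> L"
    using decseq_convergent by blast
  then have "(\<lambda>n. Inf (?S n)) \<longlonglongrightarrow> L" by (rule LIMSEQ_offset)
  then show ?thesis unfolding csp_rho_def by (simp add: limI)
qed

theorem theorem3p3:
  fixes k q :: nat and F :: "predicate set" and \<epsilon> :: real
  assumes "q \<ge> 1"
    and "F \<subseteq> predicates q k" and "finite F" and "F \<noteq> {}"
    and "\<epsilon> > 0"
  shows "\<exists>n \<Phi>. integrality_gap_instance q k F (family_width q k F) (csp_rho q k F + \<epsilon>) n \<Phi>"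
proof -
  let ?S = "\<lambda>n. {csp_opt q n \<Psi> | \<Psi>. csp_instance_on k F n \<Psi>}"
  have "\<forall>\<^sub>F n in sequentially. Inf (?S n) < csp_rho q k F + \<epsilon>"
    using order_tendstoD(2)[OF csp_rho_limit[OF assms(1,4)]] assms(5) by simp
  \<comment> \<open>Requiring \<open>k \<le> n\<close> makes \<open>?S n\<close> nonempty, so that
    an infimum below the bound yields an actual instance below it. The infimum itself need not be
    attained; the slack \<epsilon> makes up for this.\<close>
  then have "\<forall>\<^sub>F n in sequentially. Inf (?S n) < csp_rho q k F + \<epsilon> \<and> k \<le> n"
    using eventually_ge_at_top by (rule eventually_conj)
  then obtain n where n: "Inf (?S n) < csp_rho q k F + \<epsilon>" "k \<le> n"
    by (auto simp: eventually_sequentially)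
  have "?S n \<noteq> {}" using csp_instance_exists[OF assms(4) n(2)] by blast
  then obtain \<Phi> where \<Phi>: "csp_instance_on k F n \<Phi>" "csp_opt q n \<Phi> < csp_rho q k F + \<epsilon>"
    using cInf_lessD[OF _ n(1)] by blast
  then have "integrality_gap_instance q k F (family_width q k F) (csp_rho q k F + \<epsilon>) n \<Phi>"
    unfolding integrality_gap_instance_def
    using lp_opt_ge_family_width[OF assms(1-3) \<Phi>(1)] by simp
  then show ?thesis by blast
qed

end
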